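(* Let $F\subseteq E(K_n)$ be a set of $p\ge 1$ edges of the complete graph $K_n$ such that $K_n-F$ is connected. Let $Q$ be the edge-defect matrix of $F$ and let $\theta_1,\ldots,\theta_p$ be the eigenvalues of $Q$ with multiplicity, including zero eigenvalues. Then $$Kf(K_n-F)=n-1+\operatorname{tr}\left(Q(nI_p-Q)^{-1}\right)=n-1+\sum_{\alpha=1}^{p}\frac{\theta_\alpha}{n-\theta_\alpha}.$$
   Context: $K_n-F$ is the graph on the vertices of $K_n$ obtained by deleting the edges in $F=\{e_1,\ldots,e_p\}$. For each deleted edge $e_\alpha=\{u_\alpha,v_\alpha\}$ choose an arbitrary orientation and put $b_\alpha=e_{u_\alpha}-e_{v_\alpha}\in\mathbb{R}^n$, where $e_x$ is the standard basis vector of vertex $x$; put $B=[\,b_1\ \cdots\ b_p\,]$ (an $n\times p$ matrix). The edge-defect matrix of $F$ is the $p\times p$ matrix $Q=B^TB$. For a connected graph $G$ with Laplacian $L(G)=D(G)-A(G)$, the effective resistance between distinct vertices is $R_G(x,y)=(e_x-e_y)^TL(G)^+(e_x-e_y)$ ($L(G)^+$ the Moore--Penrose inverse), and the Kirchhoff index is $Kf(G)=\sum_{\{x,y\}}R_G(x,y)$, the sum over all unordered pairs of distinct vertices. *)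

theory Defs
  imports
    "Graph_Theory.Digraph_Component"
    "Jordan_Normal_Form.Char_Poly"
    "Jordan_Normal_Form.Gauss_Jordan_Elimination"
    "HOL-Computational_Algebra.Fundamental_Theorem_Algebra"
begin

text \<open>
  A graph on the vertices \<open>0, \<dots>, n - 1\<close> is given by \<open>n\<close> and its set of edges, which are
  two-element sets of vertices.
\<close>

definition complete_edges :: "nat \<Rightarrow> nat set set" where
  "complete_edges n = {{x, y} | x y. x < n \<and> y < n \<and> x \<noteq> y}"

text \<open>
  The AFP notion of connectedness is stated for digraphs; an undirected graph is viewed as the
  digraph that has both orientations of every edge as arcs.
\<close>

definition bidirected :: "nat \<Rightarrow> nat set set \<Rightarrow> (nat, nat \<times> nat) pre_digraph" where
  "bidirected n E = \<lparr>verts = {0..<n}, arcs = {(x, y). {x, y} \<in> E}, tail = fst, head = snd\<rparr>"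

definition connected_graph :: "nat \<Rightarrow> nat set set \<Rightarrow> bool" where
  "connected_graph n E \<longleftrightarrow> Digraph_Component.connected (bidirected n E)"

definition degree_mat :: "nat \<Rightarrow> nat set set \<Rightarrow> real mat" where
  "degree_mat n E = mat n n (\<lambda>(i, j). if i = j then real (card {e \<in> E. i \<in> e}) else 0)"

definition adjacency_mat :: "nat \<Rightarrow> nat set set \<Rightarrow> real mat" where
  "adjacency_mat n E = mat n n (\<lambda>(i, j). if {i, j} \<in> E then 1 else 0)"

definition laplacian :: "nat \<Rightarrow> nat set set \<Rightarrow> real mat" where
  "laplacian n E = degree_mat n E - adjacency_mat n E"

text \<open>The four Penrose equations.\<close>

definition is_moore_penrose :: "real mat \<Rightarrow> real mat \<Rightarrow> bool" where
  "is_moore_penrose A X \<longleftrightarrow>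
     X \<in> carrier_mat (dim_col A) (dim_row A) \<and>
     A * X * A = A \<and> X * A * X = X \<and> (A * X)\<^sup>T = A * X \<and> (X * A)\<^sup>T = X * A"

definition pseudoinverse :: "real mat \<Rightarrow> real mat" where
  "pseudoinverse A = (THE X. is_moore_penrose A X)"

definition effective_resistance :: "nat \<Rightarrow> nat set set \<Rightarrow> nat \<Rightarrow> nat \<Rightarrow> real" where
  "effective_resistance n E x y =
     (unit_vec n x - unit_vec n y) \<bullet>
       (pseudoinverse (laplacian n E) *\<^sub>v (unit_vec n x - unit_vec n y))"

text \<open>Every unordered pair of distinct vertices is counted once, as the pair with \<open>x < y\<close>.\<close>

definition kirchhoff_index :: "nat \<Rightarrow> nat set set \<Rightarrow> real" where
  "kirchhoff_index n E = (\<Sum>(x, y)\<in>{(x, y). x < y \<and> y < n}. effective_resistance n E x y)"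

text \<open>
  The edges \<open>{u \<alpha>, v \<alpha>}\<close> are indexed by \<open>\<alpha> = 0, \<dots>, p - 1\<close>; swapping \<open>u \<alpha>\<close> and \<open>v \<alpha>\<close> reverses
  the orientation of the edge.
\<close>

definition oriented_incidence_mat ::
    "nat \<Rightarrow> nat \<Rightarrow> (nat \<Rightarrow> nat) \<Rightarrow> (nat \<Rightarrow> nat) \<Rightarrow> real mat" where
  "oriented_incidence_mat n p u v =
     mat_of_cols n (map (\<lambda>\<alpha>. unit_vec n (u \<alpha>) - unit_vec n (v \<alpha>)) [0..<p])"

definition edge_defect_mat :: "nat \<Rightarrow> nat \<Rightarrow> (nat \<Rightarrow> nat) \<Rightarrow> (nat \<Rightarrow> nat) \<Rightarrow> real mat" where
  "edge_defect_mat n p u v =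
     (oriented_incidence_mat n p u v)\<^sup>T * oriented_incidence_mat n p u v"

definition mat_trace :: "'a :: comm_monoid_add mat \<Rightarrow> 'a" where
  "mat_trace A = (\<Sum>i<dim_row A. A $$ (i, i))"

text \<open>
  Eigenvalues with algebraic multiplicity. Only roots in the field of the entries are counted;
  by \<open>size_eigenvalues_symmetric\<close> below none are lost for a real symmetric matrix.
\<close>

definition eigenvalues :: "'a :: field mat \<Rightarrow> 'a multiset" where
  "eigenvalues A = proots (char_poly A)"

lemma moore_penrose_unique:
  assumes "is_moore_penrose A X" and "is_moore_penrose A Y"
  shows "X = Y"
proof -
  define m n where "m = dim_row A" and "n = dim_col A"
  have A: "A \<in> carrier_mat m n" and X: "X \<in> carrier_mat n m" and Y: "Y \<in> carrier_mat n m"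
    using assms by (auto simp: m_def n_def is_moore_penrose_def)
  note c = A X Y
  have x: "A * X * A = A" "X * A * X = X" "(A * X)\<^sup>T = A * X" "(X * A)\<^sup>T = X * A"
    and y: "A * Y * A = A" "Y * A * Y = Y" "(A * Y)\<^sup>T = A * Y" "(Y * A)\<^sup>T = Y * A"
    using assms by (auto simp: is_moore_penrose_def)
  have "A * X = (A * Y * A) * X" using y by simp
  also have "\<dots> = (A * Y) * (A * X)"
    using c by (intro assoc_mult_mat) auto
  also have "\<dots> = (A * Y)\<^sup>T * (A * X)\<^sup>T" using x y by simp
  also have "\<dots> = ((A * X) * (A * Y))\<^sup>T"
    using c by (subst transpose_mult[of _ m m _ m]) auto
  also have "(A * X) * (A * Y) = (A * X * A) * Y"
    using c by (intro assoc_mult_mat[symmetric]) auto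
  also have "\<dots> = A * Y" using x by simp
  finally have 1: "A * X = A * Y" using y by simp
  have "X * A = X * (A * Y * A)" using y by simp
  also have "\<dots> = (X * A) * (Y * A)"
    using c by (simp add: assoc_mult_mat[of A m n Y m A n] assoc_mult_mat[of X n m A n "Y * A" n])
  also have "\<dots> = (X * A)\<^sup>T * (Y * A)\<^sup>T" using x y by simp
  also have "\<dots> = ((Y * A) * (X * A))\<^sup>T"
    using c by (subst transpose_mult[of _ n n _ n]) auto
  also have "(Y * A) * (X * A) = Y * (A * X * A)"
    using c by (simp add: assoc_mult_mat[of A m n X m A n] assoc_mult_mat[of Y n m A n "X * A" n])
  also have "\<dots> = Y * A" using x by simp
  finally have 2: "X * A = Y * A" using y by simp
  have "X = (Y * A) * X" using x 2 by simp
  also have "\<dots> = Y * (A * X)" using c by (simp add: assoc_mult_mat[of Y n m A n X m])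
  also have "\<dots> = (Y * A) * Y" using c 1 by (simp add: assoc_mult_mat[of Y n m A n Y m])
  finally show ?thesis using y by simp
qed

lemma pseudoinverse_eq: "is_moore_penrose A X \<Longrightarrow> pseudoinverse A = X"
  unfolding pseudoinverse_def using moore_penrose_unique by blast

lemma eigenvalue_real_symmetric:
  fixes A :: "real mat"
  assumes A: "A \<in> carrier_mat p p" and sym: "A\<^sup>T = A"
    and ev: "eigenvalue (map_mat complex_of_real A) z"
  shows "z \<in> \<real>"
proof -
  define C where "C = map_mat complex_of_real A"
  have C: "C \<in> carrier_mat p p" using A by (simp add: C_def)
  obtain w where w: "w \<in> carrier_vec p" "w \<noteq> 0\<^sub>v p" "C *\<^sub>v w = z \<cdot>\<^sub>v w"
    using ev C unfolding C_def[symmetric] eigenvalue_def eigenvector_def by auto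
  define S where "S = (\<Sum>i<p. cnj (w $ i) * (C *\<^sub>v w) $ i)"
  define N where "N = (\<Sum>i<p. (cmod (w $ i))\<^sup>2)"
  have Aij: "A $$ (i, j) = A $$ (j, i)" if "i < p" "j < p" for i j
    using arg_cong[OF sym, of "\<lambda>M. M $$ (i, j)"] that A by auto
  have S1: "S = (\<Sum>i<p. \<Sum>j<p. cnj (w $ i) * of_real (A $$ (i, j)) * w $ j)"
    unfolding S_def
  proof (rule sum.cong[OF refl])
    fix i assume "i \<in> {..<p}"
    then have "(C *\<^sub>v w) $ i = (\<Sum>j<p. of_real (A $$ (i, j)) * w $ j)"
      using w(1) A by (simp add: C_def scalar_prod_def lessThan_atLeast0)
    then show "cnj (w $ i) * (C *\<^sub>v w) $ i =
        (\<Sum>j<p. cnj (w $ i) * of_real (A $$ (i, j)) * w $ j)"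
      by (simp add: sum_distrib_left mult.assoc)
  qed
  have "cnj S = (\<Sum>i<p. \<Sum>j<p. w $ i * of_real (A $$ (i, j)) * cnj (w $ j))"
    unfolding S1 by simp
  also have "\<dots> = (\<Sum>j<p. \<Sum>i<p. w $ i * of_real (A $$ (i, j)) * cnj (w $ j))"
    by (rule sum.swap)
  also have "\<dots> = S"
    unfolding S1 by (intro sum.cong refl) (simp add: Aij mult.commute mult.left_commute)
  finally have "S \<in> \<real>" by (simp add: Reals_cnj_iff)
  moreover have "S = z * of_real N"
    using w(1) unfolding S_def N_def w(3) of_real_sum sum_distrib_left
    by (intro sum.cong) (auto simp: complex_norm_square[symmetric] mult_ac simp flip: of_real_power)
  moreover have "N \<noteq> 0"
  proof
    assume "N = 0"
    then have "\<forall>i<p. w $ i = 0"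
      unfolding N_def by (subst (asm) sum_nonneg_eq_0_iff) auto
    then have "w = 0\<^sub>v p" using w(1) by (intro eq_vecI) auto
    then show False using w(2) by simp
  qed
  ultimately have "z = S / of_real N" by simp
  with \<open>S \<in> \<real>\<close> show ?thesis by (metis Reals_divide Reals_of_real)
qed

lemma size_proots_real:
  fixes q :: "real poly"
  assumes "q \<noteq> 0" and "\<And>z. poly (map_poly complex_of_real q) z = 0 \<Longrightarrow> z \<in> \<real>"
  shows "size (proots q) = Polynomial.degree q"
  using assms
proof (induction "Polynomial.degree q" arbitrary: q)
  case 0
  then show ?case using size_proots_le[of q] by simp
next
  case (Suc d)
  have "\<not> constant (poly (map_poly complex_of_real q))"
    using Suc.hyps(2) by (simp add: constant_degree degree_map_poly)
  then obtain z where z: "poly (map_poly complex_of_real q) z = 0"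
    using fundamental_theorem_of_algebra by blast
  then obtain r where r: "z = of_real r" using Suc.prems(2) by (auto elim: Reals_cases)
  have "poly q r = 0" using z unfolding r by simp
  then obtain g where g: "q = [:- r, 1:] * g" by (auto simp: poly_eq_0_iff_dvd dvd_def)
  have g0: "g \<noteq> 0" using g Suc.prems(1) by auto
  have dq: "Polynomial.degree q = Suc (Polynomial.degree g)"
    unfolding g using g0 by (subst degree_mult_eq) auto
  have "size (proots g) = Polynomial.degree g"
  proof (rule Suc.hyps(1))
    show "d = Polynomial.degree g" using dq Suc.hyps(2) by simp
    show "g \<noteq> 0" by (rule g0)
    interpret h: map_poly_inj_idom_hom complex_of_real ..
    fix z assume "poly (map_poly complex_of_real g) z = 0"
    then have "poly (map_poly complex_of_real q) z = 0"
      unfolding g h.hom_mult by simp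
    then show "z \<in> \<real>" by (rule Suc.prems(2))
  qed
  moreover have "proots q = {#r#} + proots g"
    unfolding g using g0 by (subst proots_mult) auto
  ultimately show ?case using dq by simp
qed

lemma size_eigenvalues_symmetric:
  fixes A :: "real mat"
  assumes A: "A \<in> carrier_mat p p" and sym: "A\<^sup>T = A"
  shows "size (eigenvalues A) = p"
proof -
  have "size (proots (char_poly A)) = Polynomial.degree (char_poly A)"
  proof (rule size_proots_real)
    show "char_poly A \<noteq> 0" using degree_monic_char_poly[OF A] by auto
    fix z assume "poly (map_poly complex_of_real (char_poly A)) z = 0"
    then have "poly (char_poly (map_mat complex_of_real A)) z = 0"
      by (simp add: of_real_hom.char_poly_hom[OF A])
    then have "eigenvalue (map_mat complex_of_real A) z"
      using A by (subst eigenvalue_root_char_poly[of _ p]) auto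
    then show "z \<in> \<real>" by (rule eigenvalue_real_symmetric[OF A sym])
  qed
  then show ?thesis using degree_monic_char_poly[OF A] by (simp add: eigenvalues_def)
qed

end

theory Submission
  imports Defs "Jordan_Normal_Form.Schur_Decomposition"
begin

text \<open>
  Write \<open>P = I - J/n\<close>, where \<open>J\<close> is the all-ones matrix, so that \<open>L = n P - B B\<^sup>T\<close> is the Laplacian of
  \<open>K\<^sub>n - F\<close>. If \<open>Q x = n x\<close>, then \<open>L (B x) = 0\<close>; by connectedness \<open>B x\<close> is constant, hence
  \<open>n x = B\<^sup>T B x = 0\<close>. So \<open>R = (n I - Q)\<^sup>-\<^sup>1\<close> exists, and \<open>Q R = R Q = n R - I\<close> shows that
  \<open>X = (P + B R B\<^sup>T) / n\<close> satisfies \<open>L X = X L = P\<close>; thus \<open>X\<close> is the pseudoinverse of \<open>L\<close>.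
  Its columns sum to zero, so summing the effective resistances leaves
  \<open>n tr X = tr P + tr (B R B\<^sup>T) = n - 1 + tr (Q R)\<close>. The eigenvalue form follows by
  triangularizing \<open>Q\<close> over the reals.
\<close>

subsection \<open>Trace of a resolvent\<close>

lemma smult_mat_mult_vec:
  fixes A :: "'a :: comm_semiring_0 mat"
  assumes "A \<in> carrier_mat m n" and "x \<in> carrier_vec n"
  shows "(c \<cdot>\<^sub>m A) *\<^sub>v x = c \<cdot>\<^sub>v (A *\<^sub>v x)"
  using assms by (intro eq_vecI) auto

lemma mat_trace_cyclic:
  fixes A B :: "'a :: comm_semiring_0 mat"
  assumes A: "A \<in> carrier_mat m n" and B: "B \<in> carrier_mat n m"
  shows "mat_trace (A * B) = mat_trace (B * A)"
proof -
  have "mat_trace (A * B) = (\<Sum>i<m. \<Sum>j<n. A $$ (i, j) * B $$ (j, i))"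
    using A B by (auto simp: mat_trace_def scalar_prod_def lessThan_atLeast0 intro!: sum.cong)
  also have "\<dots> = (\<Sum>j<n. \<Sum>i<m. A $$ (i, j) * B $$ (j, i))"
    by (rule sum.swap)
  also have "\<dots> = mat_trace (B * A)"
    using A B by (auto simp: mat_trace_def scalar_prod_def lessThan_atLeast0 mult.commute intro!: sum.cong)
  finally show ?thesis .
qed

lemma mat_trace_similar:
  fixes A B :: "'a :: comm_ring_1 mat"
  assumes A: "A \<in> carrier_mat n n" and P: "P \<in> carrier_mat n n" and Q: "Q \<in> carrier_mat n n"
    and PQ: "P * Q = 1\<^sub>m n"
  shows "mat_trace (Q * A * P) = mat_trace A"
proof -
  have "mat_trace (Q * A * P) = mat_trace (P * (Q * A))"
    using A P Q by (intro mat_trace_cyclic[of _ n n]) auto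
  also have "P * (Q * A) = A"
    using A P Q PQ by (simp flip: assoc_mult_mat[of P n n Q n A n])
  finally show ?thesis .
qed

text \<open>Row \<open>i\<close> of \<open>S * U = 1\<close> is solved column by column from the
  left. In column \<open>j\<close> the terms with \<open>k > j\<close> vanish because
  \<open>U\<close> is triangular and those with \<open>k < j\<close> by induction, so
  \<open>S $$ (i, j) * U $$ (j, j)\<close> is the only one left.\<close>

lemma left_inverse_upper_triangular:
  fixes S U :: "'a :: field mat"
  assumes S: "S \<in> carrier_mat n n" and U: "U \<in> carrier_mat n n"
    and ut: "upper_triangular U" and SU: "S * U = 1\<^sub>m n"
    and diag: "\<And>i. i < n \<Longrightarrow> U $$ (i, i) \<noteq> 0"
    and ij: "i < n" "j \<le> i"
  shows "S $$ (i, j) = (if i = j then 1 / U $$ (i, i) else 0)"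
  using ij(2)
proof (induction j rule: less_induct)
  case (less j)
  have j: "j < n" using less ij by simp
  have "(S * U) $$ (i, j) = (\<Sum>k<n. S $$ (i, k) * U $$ (k, j))"
    using S U ij j by (simp add: scalar_prod_def lessThan_atLeast0)
  also have "\<dots> = (\<Sum>k<n. if k = j then S $$ (i, j) * U $$ (j, j) else 0)"
  proof (rule sum.cong[OF refl])
    fix k assume k: "k \<in> {..<n}"
    consider "k < j" | "k = j" | "k > j" by linarith
    then show "S $$ (i, k) * U $$ (k, j) = (if k = j then S $$ (i, j) * U $$ (j, j) else 0)"
    proof cases
      case 1
      \<comment> \<open>Here \<open>k < j \<le> i\<close>, so \<open>k\<close> lies strictly below
        the diagonal and the induction hypothesis gives \<open>S $$ (i, k) = 0\<close>.\<close>
      then show ?thesis using less by simp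
    next
      case 3
      then have "U $$ (k, j) = 0" using upper_triangularD[OF ut] U k by auto
      then show ?thesis using 3 by simp
    qed simp
  qed
  also have "\<dots> = S $$ (i, j) * U $$ (j, j)" using j by simp
  finally have "S $$ (i, j) * U $$ (j, j) = (if i = j then 1 else 0)"
    using SU ij j by simp
  then show ?case using diag[OF j] by (auto simp: field_simps split: if_splits)
qed

text \<open>The hypothesis on \<open>size\<close> expresses that \<open>q\<close> splits. Dividing
  by the linear factor of the first listed root keeps the quotient monic and lowers both the degree
  and the number of roots by one, so the list can be peeled off in whatever order it has.\<close>

lemma proots_prod_list_linear:
  fixes q :: "'a :: field poly"
  assumes "monic q" and "size (proots q) = Polynomial.degree q" and "mset es = proots q"
  shows "q = (\<Prod>e\<leftarrow>es. [:- e, 1:])"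
  using assms
proof (induction es arbitrary: q)
  case Nil
  then have "Polynomial.degree q = 0" by simp
  then show ?case using monic_degree_0[of q] Nil.prems(1) by simp
next
  case (Cons e es)
  have "q \<noteq> 0" using Cons.prems(1) by auto
  have "e \<in># proots q" using Cons.prems(3) by (metis list.set_intros(1) set_mset_mset)
  then have "poly q e = 0" using \<open>q \<noteq> 0\<close> by simp
  then obtain g where g: "q = [:- e, 1:] * g" by (auto simp: poly_eq_0_iff_dvd dvd_def)
  have g0: "g \<noteq> 0" using g \<open>q \<noteq> 0\<close> by auto
  have p: "proots q = {#e#} + proots g"
    unfolding g using g0 by (subst proots_mult) auto
  have d: "Polynomial.degree q = Suc (Polynomial.degree g)"
    unfolding g using g0 by (subst degree_mult_eq) auto
  have "g = (\<Prod>e\<leftarrow>es. [:- e, 1:])"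
  proof (rule Cons.IH)
    show "monic g" using Cons.prems(1) unfolding g lead_coeff_mult by simp
    show "size (proots g) = Polynomial.degree g" using Cons.prems(2) p d by simp
    show "mset es = proots g" using Cons.prems(3) p by simp
  qed
  then show ?case using g by simp
qed

text \<open>This supplies the factored form that \<open>schur_decomposition\<close> expects. The
  real field suffices because a real symmetric matrix has all its eigenvalues there.\<close>

lemma char_poly_symmetric_split:
  fixes A :: "real mat"
  assumes A: "A \<in> carrier_mat p p" and sym: "A\<^sup>T = A" and es: "mset es = eigenvalues A"
  shows "char_poly A = (\<Prod>e\<leftarrow>es. [:- e, 1:])"
  using degree_monic_char_poly[OF A] size_eigenvalues_symmetric[OF A sym] es
  by (intro proots_prod_list_linear) (auto simp: eigenvalues_def)

text \<open>Schur triangularization gives \<open>A = P * T * P'\<close> with the list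
  \<open>es\<close> on the diagonal of \<open>T\<close>. In that basis \<open>R\<close> becomes
  \<open>S\<close>, an inverse of the triangular matrix \<open>t I - T\<close>, so
  \<open>T * S\<close> has the diagonal entries \<open>e / (t - e)\<close>, and the trace does not
  depend on the basis.\<close>

lemma mat_trace_resolvent:
  fixes A R :: "'a :: conjugatable_ordered_field mat"
  assumes A: "A \<in> carrier_mat p p"
    and split: "char_poly A = (\<Prod>e\<leftarrow>es. [:- e, 1:])"
    and R: "R \<in> carrier_mat p p" and RN: "R * (t \<cdot>\<^sub>m 1\<^sub>m p - A) = 1\<^sub>m p"
  shows "mat_trace (A * R) = (\<Sum>e\<leftarrow>es. e / (t - e))"
proof -
  obtain T P P' where dec: "schur_decomposition A es = (T, P, P')" by (metis prod_cases3)
  from schur_decomposition[OF A split dec]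
  have sim: "similar_mat_wit A T P P'" and ut: "upper_triangular T" and dg: "diag_mat T = es"
    by auto
  have T: "T \<in> carrier_mat p p" and P: "P \<in> carrier_mat p p" and P': "P' \<in> carrier_mat p p"
    and PP': "P * P' = 1\<^sub>m p" and P'P: "P' * P = 1\<^sub>m p" and AT: "A = P * T * P'"
    using sim A by (auto simp: similar_mat_wit_def Let_def)
  define U where "U = t \<cdot>\<^sub>m 1\<^sub>m p - T"
  define S where "S = P' * R * P"
  have U: "U \<in> carrier_mat p p" and S: "S \<in> carrier_mat p p"
    using T P P' R by (auto simp: U_def S_def)
  define N where "N = t \<cdot>\<^sub>m 1\<^sub>m p - A"
  have N: "N \<in> carrier_mat p p" using A by (auto simp: N_def)
  have AP: "A * P = P * T"
    using P P' T P'P unfolding AT by (simp add: assoc_mult_mat[of _ p p _ p _ p])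
  have NP: "N * P = P * U"
  proof -
    have "N * P = t \<cdot>\<^sub>m P - A * P"
      using A P unfolding N_def
      by (subst minus_mult_distrib_mat[of _ p p _ _ p]) (auto simp: mult_smult_assoc_mat[of _ p p _ p])
    also have "\<dots> = P * U"
      using A P T unfolding AP U_def
      by (subst mult_minus_distrib_mat[of _ p p _ p]) (auto simp: mult_smult_distrib[of _ p p _ p])
    finally show ?thesis .
  qed
  have "S * U = P' * R * (P * U)"
    using P P' R U unfolding S_def by (intro assoc_mult_mat) auto
  also have "\<dots> = P' * (R * (N * P))"
    using P P' R N unfolding NP[symmetric] by (intro assoc_mult_mat) auto
  also have "R * (N * P) = P"
    using P R N RN[folded N_def] by (simp flip: assoc_mult_mat[of R p p N p P p])
  finally have SU: "S * U = 1\<^sub>m p" using P'P by simp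
  \<comment> \<open>Since \<open>U\<close> is triangular and invertible, none of its diagonal
    entries \<open>t - e\<close> is zero; the quotients in the conclusion therefore never divide by
    zero.\<close>
  have "det S * det U = 1"
    using SU det_mult[OF S U] by simp
  then have "det U \<noteq> 0" by auto
  have utU: "upper_triangular U"
    using ut T by (auto simp: upper_triangular_def U_def)
  have nz: "U $$ (i, i) \<noteq> 0" if "i < p" for i
    using \<open>det U \<noteq> 0\<close> det_upper_triangular[OF utU U] that U
    by (auto simp: prod_list_zero_iff diag_mat_def)
  have inv: "S $$ (i, j) = (if i = j then 1 / U $$ (i, i) else 0)" if "i < p" "j \<le> i" for i j
    using left_inverse_upper_triangular[OF S U utU SU nz that] .
  have "mat_trace (A * R) = mat_trace (P' * (A * R) * P)"
    using A R P P' PP' by (intro mat_trace_similar[symmetric]) auto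
  also have "P' * (A * R) * P = T * S"
  proof -
    have "P' * (A * R) * P = P' * (A * (R * P))"
      using A R P P' by (simp add: assoc_mult_mat[of _ p p _ p _ p])
    also have "A * (R * P) = P * (T * (P' * (R * P)))"
      using A R P P' T unfolding AT by (simp add: assoc_mult_mat[of _ p p _ p _ p])
    also have "P' * \<dots> = (P' * P) * (T * (P' * (R * P)))"
      using A R P P' T by (intro assoc_mult_mat[symmetric]) auto
    also have "\<dots> = T * S"
      using R P P' T P'P by (simp add: S_def assoc_mult_mat[of _ p p _ p _ p])
    finally show ?thesis .
  qed
  also have "mat_trace (T * S) = (\<Sum>i<p. T $$ (i, i) / (t - T $$ (i, i)))"
  proof -
    have "(T * S) $$ (i, i) = T $$ (i, i) / (t - T $$ (i, i))" if i: "i < p" for i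
    proof -
      have "(T * S) $$ (i, i) = (\<Sum>k<p. T $$ (i, k) * S $$ (k, i))"
        using T S i by (simp add: scalar_prod_def lessThan_atLeast0)
      also have "\<dots> = (\<Sum>k<p. if k = i then T $$ (i, i) / U $$ (i, i) else 0)"
      proof (rule sum.cong[OF refl])
        fix k assume k: "k \<in> {..<p}"
        \<comment> \<open>Below the diagonal both factors vanish: \<open>T $$ (i, k)\<close> for
          \<open>k < i\<close> and \<open>S $$ (k, i)\<close> for \<open>k > i\<close>. Only
          \<open>k = i\<close> survives.\<close>
        show "T $$ (i, k) * S $$ (k, i) = (if k = i then T $$ (i, i) / U $$ (i, i) else 0)"
          using inv[of k i] upper_triangularD[OF ut, of k i] k i T by (cases k i rule: linorder_cases) auto
      qed
      also have "\<dots> = T $$ (i, i) / (t - T $$ (i, i))"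
        using i T by (simp add: U_def)
      finally show ?thesis .
    qed
    then show ?thesis using T S by (simp add: mat_trace_def)
  qed
  also have "\<dots> = (\<Sum>e\<leftarrow>es. e / (t - e))"
    using T by (simp add: dg[symmetric] diag_mat_def comp_def lessThan_atLeast0
        interv_sum_list_conv_sum_set_nat)
  finally show ?thesis .
qed

subsection \<open>The pseudoinverse and the Kirchhoff index\<close>

text \<open>The relation \<open>Z * K = t K - Z\<close> says \<open>(t I - Z) K = Z\<close>, so in
  \<open>(t P - Z) * (P + K)\<close> everything cancels except \<open>t P\<close>, and likewise on
  the other side. Both products of the two matrices are then the symmetric idempotent
  \<open>P\<close>, which fixes each of them from the left; this yields the four Penrose equations.
  It is applied with \<open>t = n\<close>, \<open>Z = B B^T\<close> and
  \<open>K = B R B^T\<close>.\<close>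

lemma is_moore_penroseI_projection:
  fixes P Z K :: "real mat" and t :: real
  assumes P: "P \<in> carrier_mat n n" and Z: "Z \<in> carrier_mat n n" and K: "K \<in> carrier_mat n n"
    and t: "t \<noteq> 0" and sym: "P\<^sup>T = P" and PP: "P * P = P"
    and PZ: "P * Z = Z" and ZP: "Z * P = Z" and PK: "P * K = K" and KP: "K * P = K"
    and ZK: "Z * K = t \<cdot>\<^sub>m K - Z" and KZ: "K * Z = t \<cdot>\<^sub>m K - Z"
  shows "is_moore_penrose (t \<cdot>\<^sub>m P - Z) ((1 / t) \<cdot>\<^sub>m (P + K))"
proof -
  define A X where "A = t \<cdot>\<^sub>m P - Z" and "X = (1 / t) \<cdot>\<^sub>m (P + K)"
  have A: "A \<in> carrier_mat n n" and X: "X \<in> carrier_mat n n"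
    using P Z K by (auto simp: A_def X_def)
  have distr: "(t \<cdot>\<^sub>m P - Z) * M = t \<cdot>\<^sub>m (P * M) - Z * M" if "M \<in> carrier_mat n n" for M
    using P Z that
    by (subst minus_mult_distrib_mat[of _ n n _ _ n]) (auto simp: mult_smult_assoc_mat[of _ n n _ n])
  have distl: "M * (t \<cdot>\<^sub>m P - Z) = t \<cdot>\<^sub>m (M * P) - M * Z" if "M \<in> carrier_mat n n" for M
    using P Z that
    by (subst mult_minus_distrib_mat[of _ n n _ n]) (auto simp: mult_smult_distrib[of _ n n _ n])
  have "A * X = (1 / t) \<cdot>\<^sub>m ((t \<cdot>\<^sub>m P - Z) * (P + K))"
    unfolding A_def X_def using P Z K by (intro mult_smult_distrib) auto
  also have "(t \<cdot>\<^sub>m P - Z) * (P + K) = t \<cdot>\<^sub>m P"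
    using P Z K
    by (simp add: distr mult_add_distrib_mat[of _ n n] PP PK ZP ZK) (auto simp: field_simps)
  finally have AX: "A * X = P" using P t by (auto intro!: eq_matI)
  have "X * A = (1 / t) \<cdot>\<^sub>m ((P + K) * (t \<cdot>\<^sub>m P - Z))"
    unfolding A_def X_def using P Z K by (intro mult_smult_assoc_mat) auto
  also have "(P + K) * (t \<cdot>\<^sub>m P - Z) = t \<cdot>\<^sub>m P"
    using P Z K
    by (simp add: distl add_mult_distrib_mat[of _ n n] PP KP PZ KZ) (auto simp: field_simps)
  finally have XA: "X * A = P" using P t by (auto intro!: eq_matI)
  have "P * A = A" unfolding A_def
    using P Z by (simp add: distl PP PZ)
  moreover have "P * X = X" unfolding X_def
    using P K by (simp add: mult_smult_distrib[of _ n n _ n] mult_add_distrib_mat[of _ n n] PP PK)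
  ultimately show ?thesis
    unfolding is_moore_penrose_def A_def[symmetric] X_def[symmetric]
    using A X AX XA sym by auto
qed

section \<open>The projection \<open>I - J/n\<close> onto vectors with coordinate sum zero\<close>

definition centering_mat :: "nat \<Rightarrow> real mat" where
  "centering_mat n = mat n n (\<lambda>(i, j). (if i = j then 1 else 0) - 1 / real n)"

text \<open>Subtracting \<open>J/n\<close> times \<open>M\<close> removes from each column its
  average, which is zero here. The incidence matrix and the projection itself are the two
  instances.\<close>

lemma centering_mat_mult:
  assumes M: "M \<in> carrier_mat n m" and z: "\<And>j. j < m \<Longrightarrow> (\<Sum>i<n. M $$ (i, j)) = 0"
  shows "centering_mat n * M = M"
proof (rule eq_matI)
  fix i j assume "i < dim_row M" "j < dim_col M"
  then have ij: "i < n" "j < m" using M by auto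
  have "(centering_mat n * M) $$ (i, j) =
      (\<Sum>k<n. ((if i = k then 1 else 0) - 1 / real n) * M $$ (k, j))"
    using M ij by (simp add: centering_mat_def scalar_prod_def lessThan_atLeast0)
  also have "\<dots> = (\<Sum>k<n. (if i = k then M $$ (k, j) else 0)) - (\<Sum>k<n. M $$ (k, j)) / real n"
    unfolding sum_divide_distrib sum_subtractf[symmetric]
    by (intro sum.cong) (auto simp: algebra_simps)
  finally show "(centering_mat n * M) $$ (i, j) = M $$ (i, j)" using ij z by simp
qed (use M in \<open>auto simp: centering_mat_def\<close>)

lemma transpose_centering_mat: "(centering_mat n)\<^sup>T = centering_mat n"
  by (rule eq_matI) (auto simp: centering_mat_def)

lemma centering_mat_carrier[simp]: "centering_mat n \<in> carrier_mat n n"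
  by (simp add: centering_mat_def)

lemma centering_mat_col_sum: "j < n \<Longrightarrow> (\<Sum>i<n. centering_mat n $$ (i, j)) = 0"
  by (simp add: centering_mat_def sum_subtractf)

section \<open>From resistances of pairs to the trace of the pseudoinverse\<close>

lemma sum_unordered_pairs:
  fixes f :: "nat \<Rightarrow> nat \<Rightarrow> 'a :: comm_monoid_add"
  assumes "\<And>x y. f x y = f y x" and "\<And>x. f x x = 0"
  shows "(\<Sum>x<n. \<Sum>y<n. f x y) =
    (\<Sum>(x, y)\<in>{(x, y). x < y \<and> y < n}. f x y) + (\<Sum>(x, y)\<in>{(x, y). x < y \<and> y < n}. f x y)"
proof -
  let ?A = "{(x, y). x < y \<and> y < n}" and ?B = "{(x, y). y < x \<and> x < n}"
    and ?D = "{(x, y). x = y \<and> x < n}"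
  have fin: "finite ?A" "finite ?B" "finite ?D"
    by (rule finite_subset[of _ "{..<n} \<times> {..<n}"]; force)+
  have eq: "{..<n} \<times> {..<n} = (?A \<union> ?B) \<union> ?D" by auto
  have "(\<Sum>x<n. \<Sum>y<n. f x y) = (\<Sum>(x, y)\<in>(?A \<union> ?B) \<union> ?D. f x y)"
    unfolding sum.cartesian_product eq ..
  also have "\<dots> = (\<Sum>(x, y)\<in>?A \<union> ?B. f x y) + (\<Sum>(x, y)\<in>?D. f x y)"
    using fin by (intro sum.union_disjoint) auto
  also have "(\<Sum>(x, y)\<in>?D. f x y) = 0"
    by (rule sum.neutral) (auto simp: assms)
  also have "(\<Sum>(x, y)\<in>?A \<union> ?B. f x y) = (\<Sum>(x, y)\<in>?A. f x y) + (\<Sum>(x, y)\<in>?B. f x y)"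
    using fin by (intro sum.union_disjoint) auto
  \<comment> \<open>Swapping coordinates maps the pairs below the diagonal onto those above it. The
    result is written as a sum of two equal terms since the values lie in an arbitrary commutative
    monoid.\<close>
  also have "(\<Sum>(x, y)\<in>?B. f x y) = (\<Sum>(x, y)\<in>?A. f x y)"
    by (rule sum.reindex_bij_witness[of _ prod.swap prod.swap]) (auto simp: assms(1))
  finally show ?thesis by simp
qed

lemma quadratic_form_unit_diff:
  fixes X :: "real mat"
  assumes X: "X \<in> carrier_mat n n" and xy: "x < n" "y < n"
  shows "(unit_vec n x - unit_vec n y) \<bullet> (X *\<^sub>v (unit_vec n x - unit_vec n y)) =
    X $$ (x, x) + X $$ (y, y) - X $$ (x, y) - X $$ (y, x)"
proof -
  let ?d = "unit_vec n x - unit_vec n y :: real vec"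
  have e: "(\<Sum>k<n. g k * ?d $ k) = g x - g y" for g :: "nat \<Rightarrow> real"
  proof -
    have "(\<Sum>k<n. g k * ?d $ k) = (\<Sum>k<n. (if k = x then g k else 0) - (if k = y then g k else 0))"
      using xy by (intro sum.cong) (auto simp: unit_vec_def)
    then show ?thesis using xy by (simp add: sum_subtractf)
  qed
  have "(X *\<^sub>v ?d) $ i = X $$ (i, x) - X $$ (i, y)" if "i < n" for i
  proof -
    have "(X *\<^sub>v ?d) $ i = (\<Sum>k<n. X $$ (i, k) * ?d $ k)"
      using X that by (simp add: scalar_prod_def lessThan_atLeast0)
    then show ?thesis using e by simp
  qed
  moreover have "?d \<bullet> (X *\<^sub>v ?d) = (\<Sum>k<n. (X *\<^sub>v ?d) $ k * ?d $ k)"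
    using X by (simp add: scalar_prod_def lessThan_atLeast0 mult.commute)
  ultimately show ?thesis using e xy by simp
qed

text \<open>Over all ordered pairs, which count each resistance twice, the diagonal entries of
  \<open>X\<close> contribute \<open>2 n tr X\<close>, while each cross term adds up all entries of
  \<open>X\<close> and so vanishes by the zero column sums.\<close>

lemma kirchhoff_index_eq_trace:
  assumes X: "is_moore_penrose (laplacian n E) X"
    and z: "\<And>j. j < n \<Longrightarrow> (\<Sum>i<n. X $$ (i, j)) = 0"
  shows "kirchhoff_index n E = real n * mat_trace X"
proof -
  let ?f = "\<lambda>x y. X $$ (x, x) + X $$ (y, y) - X $$ (x, y) - X $$ (y, x)"
  have Xc: "X \<in> carrier_mat n n"
    using X by (auto simp: is_moore_penrose_def laplacian_def degree_mat_def adjacency_mat_def)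
  have k: "kirchhoff_index n E = (\<Sum>(x, y)\<in>{(x, y). x < y \<and> y < n}. ?f x y)"
    unfolding kirchhoff_index_def effective_resistance_def pseudoinverse_eq[OF X]
    by (intro sum.cong) (auto simp: quadratic_form_unit_diff[OF Xc])
  have "(\<Sum>x<n. \<Sum>y<n. ?f x y) = 2 * kirchhoff_index n E"
    unfolding k by (subst sum_unordered_pairs) auto
  moreover have "(\<Sum>x<n. \<Sum>y<n. ?f x y) = 2 * (real n * mat_trace X)"
  proof -
    have "(\<Sum>x<n. \<Sum>y<n. X $$ (y, x)) = 0" using z by simp
    moreover then have "(\<Sum>x<n. \<Sum>y<n. X $$ (x, y)) = 0" by (subst sum.swap)
    ultimately show ?thesis
      using Xc by (simp add: sum.distrib sum_subtractf mat_trace_def sum_distrib_left)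
  qed
  ultimately show ?thesis by simp
qed

section \<open>The energy identity of a Laplacian and connectedness\<close>

lemma quadratic_form_row_sums_zero:
  fixes a :: "nat \<Rightarrow> nat \<Rightarrow> real"
  assumes sym: "\<And>i j. i < n \<Longrightarrow> j < n \<Longrightarrow> a i j = a j i"
    and z: "\<And>i. i < n \<Longrightarrow> (\<Sum>j<n. a i j) = 0"
  shows "2 * (\<Sum>i<n. y i * (\<Sum>j<n. a i j * y j)) = - (\<Sum>i<n. \<Sum>j<n. a i j * (y i - y j)\<^sup>2)"
proof -
  \<comment> \<open>After expanding the square, the terms with a pure square carry full row sums of
    \<open>a\<close> (for the second one after exchanging the sums and using symmetry) and vanish;
    only the mixed term remains.\<close>
  have "(\<Sum>i<n. \<Sum>j<n. a i j * (y i - y j)\<^sup>2) =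
      (\<Sum>i<n. \<Sum>j<n. a i j * (y i)\<^sup>2) + (\<Sum>i<n. \<Sum>j<n. a i j * (y j)\<^sup>2)
      - 2 * (\<Sum>i<n. \<Sum>j<n. y i * (a i j * y j))"
    unfolding sum_distrib_left sum.distrib[symmetric] sum_subtractf[symmetric]
    by (intro sum.cong refl) (simp add: power2_eq_square algebra_simps)
  also have "(\<Sum>i<n. \<Sum>j<n. a i j * (y i)\<^sup>2) = 0"
    using z by (simp flip: sum_distrib_right)
  also have "(\<Sum>i<n. \<Sum>j<n. a i j * (y j)\<^sup>2) = (\<Sum>j<n. \<Sum>i<n. a j i * (y j)\<^sup>2)"
    by (subst sum.swap) (auto intro!: sum.cong simp: sym)
  also have "\<dots> = 0"
    using z by (simp flip: sum_distrib_right)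
  finally show ?thesis by (simp add: sum_distrib_left)
qed

lemma connected_graph_constant:
  assumes con: "connected_graph n E"
    and eq: "\<And>x y. x < n \<Longrightarrow> y < n \<Longrightarrow> {x, y} \<in> E \<Longrightarrow> f x = f y"
    and xy: "x < n" "y < n"
  shows "f x = f y"
proof -
  let ?G = "mk_symmetric (bidirected n E)"
  \<comment> \<open>Connectedness of a digraph means strong connectedness of its symmetric closure,
    so \<open>y\<close> is reached from \<open>x\<close> by a directed walk, along which the
    equality is carried arc by arc.\<close>
  have "x \<rightarrow>\<^sup>*\<^bsub>with_proj ?G\<^esub> y"
    using con xy by (auto simp: connected_graph_def connected_def strongly_connected_def bidirected_def)
  then have "(x, y) \<in> rtrancl_on {0..<n} (parcs ?G)"
    by (simp add: reachable_def bidirected_def)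
  then show ?thesis
  proof induction
    case (step y z)
    then have "{y, z} \<in> E"
      by (auto simp: mk_symmetric_def bidirected_def insert_commute)
    then show ?case using step eq[of y z] by simp
  qed simp
qed


subsection \<open>Complement of an edge set in the complete graph\<close>

lemma complete_edges_iff: "{x, y} \<in> complete_edges n \<longleftrightarrow> x < n \<and> y < n \<and> x \<noteq> y"
  by (auto simp: complete_edges_def doubleton_eq_iff)

lemma edge_endpoints:
  fixes u v :: "nat \<Rightarrow> nat"
  assumes "F \<subseteq> complete_edges n" and "bij_betw (\<lambda>\<alpha>. {u \<alpha>, v \<alpha>}) {0..<p} F" and "\<alpha> < p"
  shows "u \<alpha> < n \<and> v \<alpha> < n \<and> u \<alpha> \<noteq> v \<alpha>"
proof -
  have "{u \<alpha>, v \<alpha>} \<in> F" using bij_betwE[OF assms(2)] assms(3) by simp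
  then show ?thesis using assms(1) by (auto simp flip: complete_edges_iff)
qed

lemma card_complete_edges_incident:
  assumes "i < n"
  shows "card {e \<in> complete_edges n. i \<in> e} = n - 1"
proof -
  have "{e \<in> complete_edges n. i \<in> e} = (\<lambda>j. {i, j}) ` ({..<n} - {i})"
    using assms by (auto simp: complete_edges_def insert_commute)
  moreover have "inj_on (\<lambda>j. {i, j}) ({..<n} - {i})"
    by (auto simp: inj_on_def doubleton_eq_iff)
  ultimately show ?thesis using assms by (simp add: card_image)
qed

lemma finite_complete_edges: "finite (complete_edges n)"
  by (rule finite_subset[of _ "Pow {..<n}"]) (auto simp: complete_edges_def)

section \<open>The oriented incidence matrix and the Laplacian\<close>

lemma oriented_incidence_mat_carrier[simp]: "oriented_incidence_mat n p u v \<in> carrier_mat n p"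
  by (simp add: oriented_incidence_mat_def mat_of_cols_def)

lemma oriented_incidence_mat_entry:
  assumes "i < n" and "\<alpha> < p"
  shows "oriented_incidence_mat n p u v $$ (i, \<alpha>) =
    (if i = u \<alpha> then 1 else 0) - (if i = v \<alpha> then 1 else 0)"
  using assms by (auto simp: oriented_incidence_mat_def mat_of_cols_index unit_vec_def)

lemma oriented_incidence_mat_col_sum:
  assumes "\<alpha> < p" and "u \<alpha> < n" and "v \<alpha> < n"
  shows "(\<Sum>i<n. oriented_incidence_mat n p u v $$ (i, \<alpha>)) = 0"
  using assms by (simp add: oriented_incidence_mat_entry sum_subtractf)

text \<open>\<open>B * B^T\<close> is the Laplacian of the deleted edges, whatever their
  orientation, and \<open>n (I - J/n)\<close> is that of the complete graph.\<close>

lemma laplacian_complete_minus: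
  assumes F: "F \<subseteq> complete_edges n"
    and bij: "bij_betw (\<lambda>\<alpha>. {u \<alpha>, v \<alpha>}) {0..<p} F"
  defines "B \<equiv> oriented_incidence_mat n p u v"
  shows "laplacian n (complete_edges n - F) = real n \<cdot>\<^sub>m centering_mat n - B * B\<^sup>T"
proof (rule eq_matI)
  fix i j assume "i < dim_row (real n \<cdot>\<^sub>m centering_mat n - B * B\<^sup>T)"
    and "j < dim_col (real n \<cdot>\<^sub>m centering_mat n - B * B\<^sup>T)"
  then have ij: "i < n" "j < n" by (auto simp: B_def oriented_incidence_mat_def)
  have uv: "u \<alpha> \<noteq> v \<alpha>" if "\<alpha> < p" for \<alpha>
    using edge_endpoints[OF F bij that] by simp
  have finF: "finite F" using F finite_complete_edges finite_subset by blast
  have "(B * B\<^sup>T) $$ (i, j) = (\<Sum>\<alpha>\<in>{0..<p}. B $$ (i, \<alpha>) * B $$ (j, \<alpha>))"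
    using ij by (simp add: B_def oriented_incidence_mat_def scalar_prod_def)
  \<comment> \<open>A column of \<open>B\<close> has the entries 1 and -1 at two distinct endpoints.
    A product of two entries of it is thus 1 at an endpoint with itself, -1 for the two endpoints,
    and 0 otherwise.\<close>
  also have "\<dots> = (\<Sum>\<alpha>\<in>{0..<p}. if i = j then (if i \<in> {u \<alpha>, v \<alpha>} then 1 else 0)
      else if {u \<alpha>, v \<alpha>} = {i, j} then -1 else 0)"
    using ij by (intro sum.cong) (auto simp: B_def oriented_incidence_mat_entry doubleton_eq_iff dest: uv)
  also have "\<dots> = (\<Sum>e\<in>F. if i = j then (if i \<in> e then 1 else 0) else if e = {i, j} then -1 else 0)"
    by (rule sum.reindex_bij_betw[OF bij])
  also have "\<dots> = (if i = j then real (card {e \<in> F. i \<in> e}) else if {i, j} \<in> F then -1 else 0)"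
    using finF by (simp add: sum.If_cases Int_def)
  finally have BB: "(B * B\<^sup>T) $$ (i, j) =
    (if i = j then real (card {e \<in> F. i \<in> e}) else if {i, j} \<in> F then -1 else 0)" .
  have "real (card {e \<in> complete_edges n - F. i \<in> e}) = real n - 1 - real (card {e \<in> F. i \<in> e})"
  proof -
    have eq: "{e \<in> complete_edges n - F. i \<in> e} = {e \<in> complete_edges n. i \<in> e} - {e \<in> F. i \<in> e}"
      by auto
    have sub: "{e \<in> F. i \<in> e} \<subseteq> {e \<in> complete_edges n. i \<in> e}" using F by auto
    \<comment> \<open>This bound makes the subtraction of natural numbers exact, so that it can be
      read over the reals.\<close>
    have le: "card {e \<in> F. i \<in> e} \<le> n - 1"
      using card_mono[OF _ sub] finite_complete_edges card_complete_edges_incident[OF ij(1)] by simp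
    show ?thesis unfolding eq using finF sub le ij
      by (subst card_Diff_subset) (auto simp: card_complete_edges_incident)
  qed
  then have "laplacian n (complete_edges n - F) $$ (i, j) =
      (if i = j then real n else 0) - 1 - (B * B\<^sup>T) $$ (i, j)"
    using ij complete_edges_iff[of i i n] complete_edges_iff[of i j n]
    unfolding BB by (auto simp: laplacian_def degree_mat_def adjacency_mat_def)
  also have "\<dots> = (real n \<cdot>\<^sub>m centering_mat n - B * B\<^sup>T) $$ (i, j)"
    using ij by (simp add: B_def oriented_incidence_mat_def centering_mat_def right_diff_distrib)
  finally show "laplacian n (complete_edges n - F) $$ (i, j) =
      (real n \<cdot>\<^sub>m centering_mat n - B * B\<^sup>T) $$ (i, j)" .
qed (auto simp: laplacian_def degree_mat_def adjacency_mat_def B_def oriented_incidence_mat_def)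

text \<open>A kernel vector has zero energy. The weights \<open>- ?L i j\<close> off the diagonal
  are nonnegative and the diagonal terms contain \<open>y $ i - y $ i\<close>, so every summand is
  zero; hence \<open>y\<close> agrees across each edge, and connectedness spreads this to all
  vertices.\<close>

lemma laplacian_kernel_constant:
  assumes con: "connected_graph n E"
    and z: "\<And>i. i < n \<Longrightarrow> (\<Sum>j<n. laplacian n E $$ (i, j)) = 0"
    and y: "y \<in> carrier_vec n" "laplacian n E *\<^sub>v y = 0\<^sub>v n"
    and xy: "k < n" "l < n"
  shows "y $ k = y $ l"
proof -
  let ?L = "\<lambda>i j. laplacian n E $$ (i, j)"
  have sym: "?L i j = ?L j i" if "i < n" "j < n" for i j
    using that by (auto simp: laplacian_def degree_mat_def adjacency_mat_def insert_commute)
  have off: "?L i j = (if {i, j} \<in> E then -1 else 0)" if "i < n" "j < n" "i \<noteq> j" for i j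
    using that by (auto simp: laplacian_def degree_mat_def adjacency_mat_def)
  have "(\<Sum>j<n. ?L i j * y $ j) = 0" if "i < n" for i
  proof -
    have "(laplacian n E *\<^sub>v y) $ i = (\<Sum>j<n. ?L i j * y $ j)"
      using that y(1) by (simp add: laplacian_def degree_mat_def adjacency_mat_def
          scalar_prod_def lessThan_atLeast0)
    then show ?thesis using y(2) that by simp
  qed
  then have "(\<Sum>i<n. \<Sum>j<n. ?L i j * (y $ i - y $ j)\<^sup>2) = 0"
    using quadratic_form_row_sums_zero[of n ?L "\<lambda>i. y $ i"] sym z by simp
  then have *: "(\<Sum>i<n. \<Sum>j<n. - ?L i j * (y $ i - y $ j)\<^sup>2) = 0"
    by (simp add: sum_negf)
  have nonneg: "- ?L i j * (y $ i - y $ j)\<^sup>2 \<ge> 0" if "i < n" "j < n" for i j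
    using that off[of i j] by (cases "i = j") auto
  have zero: "- ?L i j * (y $ i - y $ j)\<^sup>2 = 0" if ij: "i < n" "j < n" for i j
  proof -
    have "(\<Sum>j<n. - ?L i j * (y $ i - y $ j)\<^sup>2) = 0"
      using * ij nonneg by (subst (asm) sum_nonneg_eq_0_iff) (auto intro!: sum_nonneg)
    then show ?thesis
      using ij nonneg by (subst (asm) sum_nonneg_eq_0_iff) auto
  qed
  show ?thesis
  proof (rule connected_graph_constant[OF con _ xy])
    fix i j assume "i < n" "j < n" "{i, j} \<in> E"
    then show "y $ i = y $ j" using zero[of i j] off[of i j] by (cases "i = j") auto
  qed
qed

section \<open>Invertibility of \<open>n I - Q\<close>\<close>

lemma edge_defect_mat_carrier[simp]: "edge_defect_mat n p u v \<in> carrier_mat p p"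
  by (auto simp: edge_defect_mat_def intro!: mult_carrier_mat[of _ p n])

lemma transpose_edge_defect_mat: "(edge_defect_mat n p u v)\<^sup>T = edge_defect_mat n p u v"
  by (simp add: edge_defect_mat_def transpose_mult[of _ p n _ p])

lemma det_edge_defect_resolvent:
  assumes F: "F \<subseteq> complete_edges n"
    and bij: "bij_betw (\<lambda>\<alpha>. {u \<alpha>, v \<alpha>}) {0..<p} F"
    and con: "connected_graph n (complete_edges n - F)"
    and n: "n > 0"
  shows "det (real n \<cdot>\<^sub>m 1\<^sub>m p - edge_defect_mat n p u v) \<noteq> 0"
proof
  define B where "B = oriented_incidence_mat n p u v"
  define Q where "Q = edge_defect_mat n p u v"
  define L where "L = laplacian n (complete_edges n - F)"
  define P where "P = centering_mat n"
  have B: "B \<in> carrier_mat n p" and Q: "Q \<in> carrier_mat p p" and P: "P \<in> carrier_mat n n"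
    by (simp_all add: B_def Q_def P_def)
  have uv: "u \<alpha> < n" "v \<alpha> < n" if "\<alpha> < p" for \<alpha>
    using edge_endpoints[OF F bij that] by auto
  have PB: "P * B = B"
    unfolding P_def
    by (rule centering_mat_mult[OF B]) (auto simp: B_def oriented_incidence_mat_col_sum uv)
  have QB: "Q = B\<^sup>T * B" by (simp add: Q_def B_def edge_defect_mat_def)
  have LP: "L = real n \<cdot>\<^sub>m P - B * B\<^sup>T"
    using laplacian_complete_minus[OF F bij] by (simp add: L_def P_def B_def)
  have L: "L \<in> carrier_mat n n" unfolding LP using P B by auto
  assume "det (real n \<cdot>\<^sub>m 1\<^sub>m p - edge_defect_mat n p u v) = 0"
  then obtain x where x: "x \<in> carrier_vec p" "x \<noteq> 0\<^sub>v p"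
    and Nx: "(real n \<cdot>\<^sub>m 1\<^sub>m p - Q) *\<^sub>v x = 0\<^sub>v p"
    using det_0_iff_vec_prod_zero_field[OF minus_carrier_mat[OF Q], of "real n \<cdot>\<^sub>m 1\<^sub>m p"]
    unfolding Q_def[symmetric] by blast
  define y where "y = B *\<^sub>v x"
  have y: "y \<in> carrier_vec n" using B x by (simp add: y_def)
  have Qx: "Q *\<^sub>v x = real n \<cdot>\<^sub>v x"
  proof (rule eq_vecI)
    fix i assume "i < dim_vec (real n \<cdot>\<^sub>v x)"
    then have i: "i < p" using x by simp
    have "(real n \<cdot>\<^sub>m 1\<^sub>m p - Q) *\<^sub>v x = real n \<cdot>\<^sub>v x - Q *\<^sub>v x"
      using Q x by (subst minus_mult_distrib_mat_vec[of _ p p]) (auto simp: smult_mat_mult_vec[of _ p p])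
    then show "(Q *\<^sub>v x) $ i = (real n \<cdot>\<^sub>v x) $ i"
      using arg_cong[OF Nx, of "\<lambda>w. w $ i"] i Q x by simp
  qed (use Q x in auto)
  have Bty: "B\<^sup>T *\<^sub>v y = real n \<cdot>\<^sub>v x"
    using B x unfolding y_def Qx[symmetric] QB by (simp add: assoc_mult_mat_vec[of _ p n _ p])
  have Py: "P *\<^sub>v y = y"
    using P B x unfolding y_def by (simp add: PB flip: assoc_mult_mat_vec[of _ n n _ p])
  \<comment> \<open>With \<open>P y = y\<close> and \<open>B^T y = n x\<close>, both terms equal
    \<open>n y\<close>, because \<open>B (n x) = n (B x)\<close>.\<close>
  have "L *\<^sub>v y = real n \<cdot>\<^sub>v (P *\<^sub>v y) - B *\<^sub>v (B\<^sup>T *\<^sub>v y)"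
    using P B y unfolding LP
    by (subst minus_mult_distrib_mat_vec[of _ n n])
       (auto simp: smult_mat_mult_vec[of _ n n] assoc_mult_mat_vec[of _ n p _ n])
  also have "\<dots> = real n \<cdot>\<^sub>v y - real n \<cdot>\<^sub>v y"
    using B x unfolding Py Bty by (simp add: y_def mult_mat_vec[of _ n p])
  finally have Ly: "L *\<^sub>v y = 0\<^sub>v n" using y by auto
  have zL: "(\<Sum>j<n. L $$ (i, j)) = 0" if i: "i < n" for i
  proof -
    \<comment> \<open>By symmetry row sums become column sums, which vanish for \<open>P\<close>
      and, through its left factor, for \<open>B * B^T\<close>.\<close>
    have "(\<Sum>j<n. L $$ (i, j)) = (\<Sum>j<n. L $$ (j, i))"
      unfolding L_def using i
      by (intro sum.cong) (auto simp: laplacian_def degree_mat_def adjacency_mat_def insert_commute)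
    also have "\<dots> = real n * (\<Sum>j<n. P $$ (j, i)) - (\<Sum>j<n. \<Sum>\<alpha><p. B $$ (j, \<alpha>) * B $$ (i, \<alpha>))"
      unfolding LP using i B P
      by (simp add: sum_subtractf sum_distrib_left scalar_prod_def lessThan_atLeast0)
    also have "(\<Sum>j<n. \<Sum>\<alpha><p. B $$ (j, \<alpha>) * B $$ (i, \<alpha>)) = (\<Sum>\<alpha><p. (\<Sum>j<n. B $$ (j, \<alpha>)) * B $$ (i, \<alpha>))"
      unfolding sum_distrib_right by (rule sum.swap)
    finally show ?thesis
      using i by (simp add: P_def B_def centering_mat_col_sum oriented_incidence_mat_col_sum uv)
  qed
  have const: "y $ k = y $ l" if "k < n" "l < n" for k l
    using laplacian_kernel_constant[OF con zL[unfolded L_def] y Ly[unfolded L_def] that] .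
  have "B\<^sup>T *\<^sub>v y = 0\<^sub>v p"
  proof (rule eq_vecI)
    fix \<alpha> assume "\<alpha> < dim_vec (0\<^sub>v p)"
    then have a: "\<alpha> < p" by simp
    have "(B\<^sup>T *\<^sub>v y) $ \<alpha> = (\<Sum>k<n. B $$ (k, \<alpha>) * y $ k)"
      using B y a by (simp add: scalar_prod_def lessThan_atLeast0)
    \<comment> \<open>The constant value of \<open>y\<close> is read off at vertex 0, which exists
      since \<open>n > 0\<close>; what remains is a column sum of \<open>B\<close>.\<close>
    also have "\<dots> = (\<Sum>k<n. B $$ (k, \<alpha>)) * y $ 0"
      unfolding sum_distrib_right
    proof (rule sum.cong[OF refl])
      fix k assume "k \<in> {..<n}"
      then show "B $$ (k, \<alpha>) * y $ k = B $$ (k, \<alpha>) * y $ 0"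
        using const[of k 0] n by simp
    qed
    finally show "(B\<^sup>T *\<^sub>v y) $ \<alpha> = 0\<^sub>v p $ \<alpha>"
      using a uv by (simp add: B_def oriented_incidence_mat_col_sum)
  qed (use B in auto)
  then have "real n \<cdot>\<^sub>v x = 0\<^sub>v p" using Bty by simp
  have "x $ i = 0" if "i < p" for i
    using arg_cong[OF \<open>real n \<cdot>\<^sub>v x = 0\<^sub>v p\<close>, of "\<lambda>w. w $ i"] that x n by simp
  then have "x = 0\<^sub>v p"
    using x by (intro eq_vecI) auto
  then show False using x by simp
qed

text \<open>A nonzero determinant makes \<open>A\<close> a unit of the matrix ring, so
  \<open>mat_inverse\<close> returns \<open>Some\<close> and \<open>the\<close> extracts a genuine
  two-sided inverse.\<close>

lemma mat_inverse_of_det_nonzero: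
  fixes A :: "'a :: field mat"
  assumes A: "A \<in> carrier_mat n n" and d: "det A \<noteq> 0"
  shows "the (mat_inverse A) \<in> carrier_mat n n"
    and "A * the (mat_inverse A) = 1\<^sub>m n" and "the (mat_inverse A) * A = 1\<^sub>m n"
proof -
  have "A \<in> Units (ring_mat TYPE('a) n ())" by (rule det_non_zero_imp_unit[OF A d])
  then obtain X where X: "mat_inverse A = Some X"
    using mat_inverse(1)[OF A, of "()"] by (cases "mat_inverse A") auto
  show "the (mat_inverse A) \<in> carrier_mat n n"
    and "A * the (mat_inverse A) = 1\<^sub>m n" and "the (mat_inverse A) * A = 1\<^sub>m n"
    using mat_inverse(2)[OF A X] X by auto
qed

section \<open>The Kirchhoff index through the explicit pseudoinverse\<close>

lemma kirchhoff_index_complete_minus: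
  assumes F: "F \<subseteq> complete_edges n"
    and bij: "bij_betw (\<lambda>\<alpha>. {u \<alpha>, v \<alpha>}) {0..<p} F"
    and n: "n > 0"
    and R: "R \<in> carrier_mat p p"
    and NR: "(real n \<cdot>\<^sub>m 1\<^sub>m p - edge_defect_mat n p u v) * R = 1\<^sub>m p"
    and RN: "R * (real n \<cdot>\<^sub>m 1\<^sub>m p - edge_defect_mat n p u v) = 1\<^sub>m p"
  shows "kirchhoff_index n (complete_edges n - F) =
    real n - 1 + mat_trace (edge_defect_mat n p u v * R)"
proof -
  define B where "B = oriented_incidence_mat n p u v"
  define Q where "Q = edge_defect_mat n p u v"
  define P where "P = centering_mat n"
  have B: "B \<in> carrier_mat n p" and Q: "Q \<in> carrier_mat p p" and P: "P \<in> carrier_mat n n"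
    by (simp_all add: B_def Q_def P_def)
  have C: "B\<^sup>T \<in> carrier_mat p n" using B by simp
  have QB: "Q = B\<^sup>T * B" by (simp add: Q_def B_def edge_defect_mat_def)
  have uv: "u \<alpha> < n" "v \<alpha> < n" if "\<alpha> < p" for \<alpha>
    using edge_endpoints[OF F bij that] by auto
  have PB: "P * B = B"
    unfolding P_def
    by (rule centering_mat_mult[OF B]) (auto simp: B_def oriented_incidence_mat_col_sum uv)
  have symP: "P\<^sup>T = P" by (simp add: P_def transpose_centering_mat)
  have CP: "B\<^sup>T * P = B\<^sup>T"
    using arg_cong[OF PB, of transpose_mat] transpose_mult[OF P B] symP by simp
  have PP: "P * P = P"
    unfolding P_def by (rule centering_mat_mult[of _ n n]) (auto simp: centering_mat_col_sum)
  have QR: "Q * R = real n \<cdot>\<^sub>m R - 1\<^sub>m p"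
  proof -
    have "real n \<cdot>\<^sub>m R - Q * R = 1\<^sub>m p"
      using NR R Q by (subst (asm) minus_mult_distrib_mat[of _ p p _ _ p])
        (auto simp: Q_def mult_smult_assoc_mat[of _ p p _ p])
    moreover have "Q * R = real n \<cdot>\<^sub>m R - (real n \<cdot>\<^sub>m R - Q * R)"
      using R Q by (intro eq_matI) auto
    ultimately show ?thesis by simp
  qed
  have RQ: "R * Q = real n \<cdot>\<^sub>m R - 1\<^sub>m p"
  proof -
    have "real n \<cdot>\<^sub>m R - R * Q = 1\<^sub>m p"
      using RN R Q by (subst (asm) mult_minus_distrib_mat[of _ p p _ p])
        (auto simp: Q_def mult_smult_distrib[of _ p p _ p])
    moreover have "R * Q = real n \<cdot>\<^sub>m R - (real n \<cdot>\<^sub>m R - R * Q)"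
      using R Q by (intro eq_matI) auto
    ultimately show ?thesis by simp
  qed
  define Z K where "Z = B * B\<^sup>T" and "K = B * (R * B\<^sup>T)"
  have Z: "Z \<in> carrier_mat n n" and K: "K \<in> carrier_mat n n"
    using B R by (auto simp: Z_def K_def)
  have PZ: "P * Z = Z"
    using P B PB unfolding Z_def by (simp flip: assoc_mult_mat[OF P B C])
  have ZP: "Z * P = Z"
    using CP unfolding Z_def by (simp add: assoc_mult_mat[OF B C P])
  have PK: "P * K = K"
    using PB R C unfolding K_def by (simp flip: assoc_mult_mat[OF P B, of "R * B\<^sup>T" n])
  have KP: "K * P = K"
    using CP B R C P unfolding K_def
    by (simp add: assoc_mult_mat[of B n p "R * B\<^sup>T" n P n] assoc_mult_mat[OF R C P])
  \<comment> \<open>Regrouping gives \<open>Z K = B (Q R) B^T = B (n R - I) B^T\<close>. The product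
    in the other order uses \<open>R Q\<close> in the same way.\<close>
  have ZK: "Z * K = real n \<cdot>\<^sub>m K - Z"
  proof -
    have "Z * K = B * (B\<^sup>T * (B * (R * B\<^sup>T)))"
      unfolding Z_def K_def using B R C by (intro assoc_mult_mat) auto
    also have "B\<^sup>T * (B * (R * B\<^sup>T)) = Q * (R * B\<^sup>T)"
      unfolding QB using B R C by (intro assoc_mult_mat[symmetric]) auto
    also have "\<dots> = (real n \<cdot>\<^sub>m R - 1\<^sub>m p) * B\<^sup>T"
      using Q R C unfolding QR[symmetric] by (intro assoc_mult_mat[symmetric]) auto
    also have "\<dots> = real n \<cdot>\<^sub>m (R * B\<^sup>T) - B\<^sup>T"
      using R C by (subst minus_mult_distrib_mat[of _ p p _ _ n])
        (auto simp: mult_smult_assoc_mat[of _ p p _ n])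
    also have "B * \<dots> = real n \<cdot>\<^sub>m K - Z"
      unfolding K_def Z_def using B R C by (subst mult_minus_distrib_mat[of _ n p _ n])
        (auto simp: mult_smult_distrib[of _ n p _ n])
    finally show ?thesis .
  qed
  have KZ: "K * Z = real n \<cdot>\<^sub>m K - Z"
  proof -
    have "K * Z = B * (R * B\<^sup>T * (B * B\<^sup>T))"
      unfolding Z_def K_def using B R C by (intro assoc_mult_mat) auto
    also have "R * B\<^sup>T * (B * B\<^sup>T) = R * (B\<^sup>T * (B * B\<^sup>T))"
      using B R C by (intro assoc_mult_mat) auto
    also have "B\<^sup>T * (B * B\<^sup>T) = Q * B\<^sup>T"
      unfolding QB using B C by (intro assoc_mult_mat[symmetric]) auto
    also have "R * (Q * B\<^sup>T) = (real n \<cdot>\<^sub>m R - 1\<^sub>m p) * B\<^sup>T"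
      using Q R C unfolding RQ[symmetric] by (intro assoc_mult_mat[symmetric]) auto
    also have "\<dots> = real n \<cdot>\<^sub>m (R * B\<^sup>T) - B\<^sup>T"
      using R C by (subst minus_mult_distrib_mat[of _ p p _ _ n])
        (auto simp: mult_smult_assoc_mat[of _ p p _ n])
    also have "B * \<dots> = real n \<cdot>\<^sub>m K - Z"
      unfolding K_def Z_def using B R C by (subst mult_minus_distrib_mat[of _ n p _ n])
        (auto simp: mult_smult_distrib[of _ n p _ n])
    finally show ?thesis .
  qed
  define X where "X = (1 / real n) \<cdot>\<^sub>m (P + K)"
  have X: "X \<in> carrier_mat n n" using P K by (simp add: X_def)
  have mp: "is_moore_penrose (laplacian n (complete_edges n - F)) X"
    unfolding laplacian_complete_minus[OF F bij] X_def B_def[symmetric] P_def[symmetric]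
      Z_def[symmetric]
    using n by (intro is_moore_penroseI_projection[of _ n] P Z K symP PP PZ ZP PK KP ZK KZ) auto
  have colK: "(\<Sum>i<n. K $$ (i, j)) = 0" if j: "j < n" for j
  proof -
    \<comment> \<open>The columns of \<open>K\<close> are combinations of the columns of
      \<open>B\<close>, whose sums are zero.\<close>
    have "(\<Sum>i<n. K $$ (i, j)) = (\<Sum>i<n. \<Sum>\<alpha><p. B $$ (i, \<alpha>) * (R * B\<^sup>T) $$ (\<alpha>, j))"
      using B R C j by (auto simp: K_def scalar_prod_def lessThan_atLeast0 intro!: sum.cong)
    also have "\<dots> = (\<Sum>\<alpha><p. (\<Sum>i<n. B $$ (i, \<alpha>)) * (R * B\<^sup>T) $$ (\<alpha>, j))"
      unfolding sum_distrib_right by (rule sum.swap)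
    finally show ?thesis by (simp add: B_def oriented_incidence_mat_col_sum uv)
  qed
  have colX: "(\<Sum>i<n. X $$ (i, j)) = 0" if "j < n" for j
    using P K that colK[OF that] centering_mat_col_sum[OF that]
    by (simp add: X_def P_def sum.distrib flip: sum_divide_distrib)
  have "kirchhoff_index n (complete_edges n - F) = real n * mat_trace X"
    by (rule kirchhoff_index_eq_trace[OF mp colX])
  also have "\<dots> = mat_trace P + mat_trace K"
    using P K n by (simp add: X_def mat_trace_def sum.distrib flip: sum_divide_distrib)
  also have "mat_trace P = real n - 1"
    using n by (simp add: P_def centering_mat_def mat_trace_def sum_subtractf field_simps)
  \<comment> \<open>Moving \<open>B\<close> to the end by cyclicity turns an \<open>n\<close> by
    \<open>n\<close> trace into a \<open>p\<close> by \<open>p\<close> one and creates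
    \<open>B^T B = Q\<close>.\<close>
  also have "mat_trace K = mat_trace (R * B\<^sup>T * B)"
    unfolding K_def using B R by (intro mat_trace_cyclic[of _ n p]) auto
  also have "R * B\<^sup>T * B = R * Q"
    unfolding QB using B R by (intro assoc_mult_mat) auto
  also have "mat_trace (R * Q) = mat_trace (Q * R)"
    using R Q by (rule mat_trace_cyclic)
  finally show ?thesis by (simp add: Q_def)
qed

theorem theorem4p1:
  fixes n p :: nat and F :: "nat set set"
    and u v :: "nat \<Rightarrow> nat" and Q :: "real mat"
    and \<theta> :: "nat \<Rightarrow> real"
  assumes "F \<subseteq> complete_edges n"
    and "p \<ge> 1"
    and "bij_betw (\<lambda>\<alpha>. {u \<alpha>, v \<alpha>}) {0..<p} F"
    and "connected_graph n (complete_edges n - F)"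
    and "Q = edge_defect_mat n p u v"
    and "mset (map \<theta> [0..<p]) = eigenvalues Q"
  shows "invertible_mat (real n \<cdot>\<^sub>m 1\<^sub>m p - Q) \<and>
         kirchhoff_index n (complete_edges n - F) =
           real n - 1 + mat_trace (Q * the (mat_inverse (real n \<cdot>\<^sub>m 1\<^sub>m p - Q))) \<and>
         real n - 1 + mat_trace (Q * the (mat_inverse (real n \<cdot>\<^sub>m 1\<^sub>m p - Q))) =
           real n - 1 + (\<Sum>\<alpha>\<in>{0..<p}. \<theta> \<alpha> / (real n - \<theta> \<alpha>))"
proof -
  \<comment> \<open>A deleted edge exists because \<open>p \<ge> 1\<close>, which excludes
    \<open>n = 0\<close> and permits division by \<open>n\<close>.\<close>
  have "F \<noteq> {}" using bij_betw_same_card[OF assms(3)] assms(2) by auto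
  then have n: "n > 0" using assms(1) by (auto simp: complete_edges_def)
  define N where "N = real n \<cdot>\<^sub>m 1\<^sub>m p - Q"
  define R where "R = the (mat_inverse N)"
  have Q: "Q \<in> carrier_mat p p" and symQ: "Q\<^sup>T = Q"
    by (simp_all add: assms(5) transpose_edge_defect_mat)
  have N: "N \<in> carrier_mat p p" using Q by (auto simp: N_def)
  have "det N \<noteq> 0"
    unfolding N_def assms(5) by (rule det_edge_defect_resolvent[OF assms(1,3,4) n])
  note R = mat_inverse_of_det_nonzero[OF N this, folded R_def]
  have "invertible_mat N"
    unfolding invertible_mat_def inverts_mat_def
    using N R by (intro conjI exI[of _ R]) auto
  moreover have "kirchhoff_index n (complete_edges n - F) = real n - 1 + mat_trace (Q * R)"
    using kirchhoff_index_complete_minus[OF assms(1,3) n R(1)] R(2,3) by (simp add: N_def assms(5))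
  \<comment> \<open>The resolvent formula at \<open>t = n\<close>, with \<open>\<theta>\<close>
    listing the eigenvalue multiset in an arbitrary order.\<close>
  moreover have "mat_trace (Q * R) = (\<Sum>\<alpha>\<in>{0..<p}. \<theta> \<alpha> / (real n - \<theta> \<alpha>))"
    using mat_trace_resolvent[OF Q char_poly_symmetric_split[OF Q symQ assms(6)] R(1)] R(3)
    by (simp add: N_def comp_def interv_sum_list_conv_sum_set_nat)
  ultimately show ?thesis by (simp add: N_def R_def)
qed

end
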